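(* Let $\lambda_1$ be the missing digits measure on $\mathbb{R}$ with base $10^{10000}$ and digit set $\{1,2,\dots,10^{5005}\}$, and let $\lambda_2$ be the missing digits measure on $\mathbb{R}$ with base $11^{10000}$ and digit set $\{1,2,\dots,11^{5005}\}$. For $x\in\mathbb{R}$ let $T_x:\mathbb{R}\to\mathbb{R}$, $T_x(y)=xy$. Then for Lebesgue almost all $x\in\mathbb{R}$, the set $\mathrm{supp}(\lambda_1)+T_x(\mathrm{supp}(\lambda_2))$ has non-empty interior in $\mathbb{R}$.
   Context: Missing digits measure: for an integer $p\ge 3$ and a non-empty set $D\subset\{0,\dots,p-1\}$, the missing digits measure $\lambda_{p,D}$ with base $p$ and digit set $D$ is the Borel probability measure on $\mathbb{R}$ that is the distribution of the random sum $S=\sum_{i\ge 1}p^{-i}\mathbf{d}_i$, where the $\mathbf{d}_i$ are chosen independently and uniformly at random from $D$ (each element having probability $1/\#D$). For $A,B\subset\mathbb{R}$, $A+B=\{a+b:a\in A,b\in B\}$. *)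

theory Defs
  imports "HOL-Probability.Probability" "HOL-Library.Set_Algebras"
begin

text \<open>Digits are indexed from 0, so \<open>d i\<close> here is the digit of index \<open>i + 1\<close> in
  the expansion \<open>S = (\<Sum>i\<ge>1. d\<^sub>i / p ^ i)\<close>.\<close>

definition digit_sum :: "nat \<Rightarrow> (nat \<Rightarrow> nat) \<Rightarrow> real" where
  "digit_sum p d = (\<Sum>i. real (d i) / real p ^ Suc i)"

text \<open>Only meaningful for \<open>p \<ge> 3\<close> and non-empty \<open>D \<subseteq> {0..<p}\<close>:
  \<open>pmf_of_set\<close> is unspecified on empty or infinite sets, and \<open>suminf\<close> on divergent series.\<close>

definition missing_digits_measure :: "nat \<Rightarrow> nat set \<Rightarrow> real measure" where
  "missing_digits_measure p D =
     distr (PiM UNIV (\<lambda>i::nat. measure_pmf (pmf_of_set D))) borel (digit_sum p)"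

definition measure_supp :: "'a::topological_space measure \<Rightarrow> 'a set" where
  "measure_supp M = {x. \<forall>U. open U \<longrightarrow> x \<in> U \<longrightarrow> emeasure M U > 0}"

lemma measurable_digit_sum:
  "digit_sum p \<in> borel_measurable (PiM UNIV (\<lambda>i::nat. measure_pmf (pmf_of_set D)))"
  unfolding digit_sum_def by measurable

lemma prob_space_missing_digits_measure: "prob_space (missing_digits_measure p D)"
proof -
  interpret product_prob_space "\<lambda>i::nat. measure_pmf (pmf_of_set D)" UNIV
    by unfold_locales
  show ?thesis
    unfolding missing_digits_measure_def
    by (rule prob_space_distr) (rule measurable_digit_sum)
qed

lemma summable_digit_sum:
  assumes "p \<ge> 2" "\<And>i. d i < p"
  shows "summable (\<lambda>i. real (d i) / real p ^ Suc i)"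
proof (rule summable_comparison_test')
  show "summable (\<lambda>i. (1 / real p) ^ i)"
    using assms(1) by (intro summable_geometric) auto
  show "norm (real (d i) / real p ^ Suc i) \<le> (1 / real p) ^ i" if "i \<ge> 0" for i
    using assms(1) assms(2)[of i] by (simp add: field_simps)
qed

end

theory Submission
  imports Defs "HOL-Library.Periodic_Fun"
begin

text \<open>
  Write \<open>\<lambda>\<^sub>1, \<lambda>\<^sub>2\<close> for the two measures, \<open>K\<^sub>1, K\<^sub>2\<close> for their supports and \<open>\<phi>\<^sub>1, \<phi>\<^sub>2\<close> for their
  characteristic functions. The law of \<open>y + x z\<close> under \<open>\<lambda>\<^sub>1 \<otimes> \<lambda>\<^sub>2\<close> is carried by the compact set
  \<open>K\<^sub>1 + x K\<^sub>2\<close> and has characteristic function \<open>\<phi>\<^sub>1(t) \<phi>\<^sub>2(x t)\<close>. If the latter is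
  integrable, Fourier inversion gives the law a continuous density, and a closed set that carries a
  law with continuous density has an interior point (\<open>interior_nonempty_if_integrable_char\<close>). So it
  suffices that \<open>\<phi>\<^sub>1(t) \<phi>\<^sub>2(x t)\<close> is integrable in \<open>t\<close> for almost every \<open>x\<close>.

  Estimates of \<open>L\<^sup>2\<close> averages would only yield a square-integrable density, from which no interior point
  follows, so the proof bounds \<open>L\<^sup>1\<close> averages. Self-similarity reads
  \<open>\<phi>(t) = G(t/p) \<phi>(t/p)\<close>, where the kernel \<open>G\<close> of the digit set \<open>{1..N}\<close> is a normalised Dirichlet
  kernel. Splitting the translates \<open>t + 2\<pi>j\<close>, \<open>j < p\<^sup>n\<close>, by the residue of \<open>j\<close> modulo \<open>p\<close> peels off
  one factor \<open>G\<close> at a time, so that \<open>\<bar>\<phi>\<bar>\<close> summed over these translates is at most \<open>B\<^sup>n\<close>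
  (\<open>sum_blocks_le_power\<close>), with \<open>B\<close> a bound for the sums of \<open>\<bar>G\<bar>\<close> over \<open>p\<close> equally spaced points.
  As \<open>\<bar>G(\<theta>)\<bar>\<close> is at most \<open>1 / (N \<bar>sin (\<theta>/2)\<bar>)\<close>, that sum is harmonic up to two
  terms and \<open>B = 2 + 2 (p/N) (1 + ln p)\<close> will do (\<open>sum_norm_digit_kernel_le\<close>).
  For \<open>p = b\<^sup>1\<^sup>0\<^sup>0\<^sup>0\<^sup>0\<close>, \<open>N = b\<^sup>5\<^sup>0\<^sup>0\<^sup>5\<close> the logarithm is far smaller than the five spare powers of \<open>b\<close>,
  hence \<open>B < \<surd>p\<close> (\<open>kernel_sum_bound_lt_sqrt\<close>).

  Thus the integral of \<open>\<bar>\<phi>\<^sub>2\<bar>\<close> over \<open>[-R, R]\<close> is \<open>O(\<surd>R)\<close>, and so the integral of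
  \<open>\<bar>\<phi>\<^sub>2(x t)\<bar>\<close> over bounded \<open>x\<close> is \<open>O(\<bar>t\<bar>\<^sup>-\<^sup>1\<^sup>/\<^sup>2)\<close>. By Tonelli it remains to integrate
  \<open>\<bar>\<phi>\<^sub>1(t)\<bar> \<bar>t\<bar>\<^sup>-\<^sup>1\<^sup>/\<^sup>2\<close>; on the \<open>n\<close>-th \<open>p\<close>-adic shell this is \<open>O((B/\<surd>p)\<^sup>n)\<close>, a convergent geometric
  series (\<open>AE_finite_nn_integral_scaled_product\<close>).
\<close>

section \<open>The Dirichlet kernel of an interval of digits\<close>

text \<open>
  The characteristic function of the uniform distribution on \<open>{1..N}\<close>.
\<close>

definition digit_kernel :: "nat \<Rightarrow> real \<Rightarrow> complex" where
  "digit_kernel N t = (\<Sum>d=1..N. iexp (t * real d)) / of_nat N"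

lemma norm_digit_kernel_le_1: "norm (digit_kernel N t) \<le> 1"
proof (cases "N = 0")
  case False
  have "norm (\<Sum>d=1..N. iexp (t * real d)) \<le> (\<Sum>d=1..N. 1)"
    by (rule order.trans[OF norm_sum]) (simp del: of_real_mult)
  then show ?thesis using False by (simp add: digit_kernel_def norm_divide divide_simps)
qed (simp add: digit_kernel_def)

text \<open>
  Summing the geometric series gives \<open>N G(t) (1 - e\<^sup>i\<^sup>t) = e\<^sup>i\<^sup>t (1 - e\<^sup>i\<^sup>N\<^sup>t)\<close>, and
  \<open>\<bar>1 - e\<^sup>i\<^sup>t\<bar> = 2 \<bar>sin (t/2)\<bar>\<close>.
\<close>

lemma norm_digit_kernel_mult_sin_le: "norm (digit_kernel N t) * (real N * \<bar>sin (t / 2)\<bar>) \<le> 1"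
proof -
  define z where "z = iexp t"
  have pow: "iexp (t * real d) = z ^ d" for d
    unfolding z_def exp_of_nat_mult[symmetric] by (simp add: mult_ac)
  have geo: "(1 - z) * (\<Sum>d=1..N. z ^ d) = z - z ^ Suc N"
  proof (induction N)
    case (Suc N)
    have "(1 - z) * (\<Sum>d=1..Suc N. z ^ d) = (1 - z) * (\<Sum>d=1..N. z ^ d) + (1 - z) * z ^ Suc N"
      by (simp add: distrib_left)
    also have "\<dots> = z - z ^ Suc (Suc N)" unfolding Suc.IH by (simp add: algebra_simps)
    finally show ?case .
  qed simp
  have nz: "norm (1 - z) = 2 * \<bar>sin (t / 2)\<bar>"
  proof -
    have "(norm (1 - z))\<^sup>2 = (1 - cos t)\<^sup>2 + (sin t)\<^sup>2"
      by (simp add: z_def cmod_power2 Re_exp Im_exp)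
    also have "\<dots> = 2 - 2 * cos (2 * (t/2))"
      using sin_cos_squared_add[of t] by (simp add: power2_eq_square algebra_simps)
    also have "\<dots> = (2 * \<bar>sin (t / 2)\<bar>)\<^sup>2"
      unfolding cos_double_sin by (simp add: power2_eq_square algebra_simps)
    finally show ?thesis by (rule power2_eq_imp_eq) auto
  qed
  have "norm (z - z ^ Suc N) \<le> norm z + norm (z ^ Suc N)" by (rule norm_triangle_ineq4)
  also have "\<dots> = 2" by (simp add: z_def norm_power norm_mult)
  finally have "norm (1 - z) * norm (\<Sum>d=1..N. z ^ d) \<le> 2"
    unfolding norm_mult[symmetric] geo .
  then have "\<bar>sin (t / 2)\<bar> * norm (\<Sum>d=1..N. z ^ d) \<le> 1" unfolding nz by simp
  then show ?thesis
    unfolding digit_kernel_def pow by (cases "N = 0") (simp_all add: norm_divide mult_ac)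
qed

lemma digit_kernel_periodic: "digit_kernel N (t + 2 * pi) = digit_kernel N t"
proof -
  have "iexp ((t + 2 * pi) * real d) = iexp (t * real d)" for d
  proof -
    have "iexp ((t + 2 * pi) * real d) = iexp (t * real d) * iexp (2 * pi * real d)"
      unfolding exp_add[symmetric] by (rule arg_cong[where f=exp]) (simp add: algebra_simps)
    also have "iexp (2 * pi * real d) = 1"
      using exp_integer_2pi[of "of_nat d"] by (simp add: mult_ac)
    finally show ?thesis by simp
  qed
  then show ?thesis by (simp add: digit_kernel_def)
qed

interpretation digit_kernel: periodic_fun_simple "digit_kernel N" "2 * pi" for N
  by unfold_locales (rule digit_kernel_periodic)

text \<open>
  A sum over equally spaced points of one period is itself periodic, with the spacing as period.
  This places the first point next to the origin, where the pole of \<open>1 / sin\<close> is easy to locate.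
\<close>

lemma sum_shift_periodic:
  fixes f :: "real \<Rightarrow> real" and c :: real and p :: nat
  assumes per: "\<And>t. f (t + c) = f t" and "p > 0"
  and "c > 0"
  obtains s where "0 \<le> s" "s < c / p" "(\<Sum>k<p. f (t + c * k / p)) = (\<Sum>k<p. f (s + c * k / p))"
proof -
  let ?S = "\<lambda>t. \<Sum>k<p. f (t + c * real k / p)"
  interpret S: periodic_fun_simple ?S "c / p"
  proof
    fix t
    have "?S (t + c / p) = (\<Sum>k<p. f (t + c * real (Suc k) / p))"
      by (intro sum.cong refl arg_cong[where f=f]) (simp add: field_simps)
    also have "\<dots> = (\<Sum>k<Suc p. f (t + c * real k / p)) - f t"
      unfolding sum.lessThan_Suc_shift by simp
    also have "\<dots> = ?S t"
      using \<open>p > 0\<close> per[of t] by simp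
    finally show "?S (t + c / p) = ?S t" .
  qed
  define q where "q = \<lfloor>t / (c / p)\<rfloor>"
  define s where "s = t - of_int q * (c / p)"
  have pos: "c / p > 0" using assms by simp
  have "of_int q \<le> t / (c / p)" "t / (c / p) < of_int q + 1"
    unfolding q_def by linarith+
  with pos have "of_int q * (c / p) \<le> t" "t < (of_int q + 1) * (c / p)"
    by (auto simp only: pos_le_divide_eq pos_divide_less_eq)
  then have "0 \<le> s" "s < c / p" unfolding s_def distrib_right by linarith+
  moreover have "?S t = ?S s"
    unfolding s_def by (rule S.minus_of_int[symmetric])
  ultimately show ?thesis by (rule that)
qed

lemma sin_ge_third:
  assumes "0 \<le> y" "y \<le> 2" shows "sin y \<ge> y / (3::real)"
proof -
  have "\<bar>sin y - (\<Sum>m<3. sin_coeff m * y ^ m)\<bar> \<le> inverse (fact 3) * \<bar>y\<bar> ^ 3"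
    by (rule Maclaurin_sin_bound)
  then have "\<bar>sin y - y\<bar> \<le> y ^ 3 / 6"
    using assms by (simp add: numeral_3_eq_3 sin_coeff_def)
  then have "y - sin y \<le> y ^ 3 / 6" by linarith
  also have "y ^ 3 / 6 \<le> y * 2 ^ 2 / 6"
    using mult_left_mono[OF power_mono[OF assms(2,1), of 2] assms(1)]
    by (simp add: power3_eq_cube power2_eq_square mult_ac)
  finally show ?thesis by simp
qed

text \<open>
  The sum on the right stands for a maximum: only the distance of \<open>y\<close> to the nearer end of
  \<open>[0, \<pi>]\<close> matters, and adding both terms saves a case distinction when this is summed up.
\<close>

lemma inverse_sin_le:
  assumes "0 < a" "a \<le> y" "0 < b" "b \<le> pi - y"
  shows "sin y > 0" "1 / sin y \<le> 3 / a + 3 / b"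
proof -
  show "sin y > 0" using assms by (intro sin_gt_zero) auto
  have "sin y \<ge> a / 3 \<or> sin y \<ge> b / 3"
  proof (cases "y \<le> pi / 2")
    case True
    with pi_half_less_two sin_ge_third[of y] assms show ?thesis by auto
  next
    case False
    with pi_half_less_two sin_ge_third[of "pi - y"] assms show ?thesis by auto
  qed
  then have "1 / sin y \<le> 3 / a \<or> 1 / sin y \<le> 3 / b"
    using assms \<open>sin y > 0\<close> by (auto simp: field_simps)
  moreover have "3 / a > 0" "3 / b > 0" using assms by auto
  ultimately show "1 / sin y \<le> 3 / a + 3 / b" by linarith
qed

lemma harm_le_ln: "n > 0 \<Longrightarrow> harm n \<le> 1 + ln (real n)"
  using decseqD[OF decseq_harm_diff_ln, of 0 "n - 1"] by (simp add: harm_expand)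

text \<open>
  After the shift, the \<open>k\<close>-th half angle lies in \<open>[\<pi>k/p, \<pi>(k+1)/p)\<close>. The first and last
  terms, which are close to multiples of \<open>2\<pi>\<close>, are bounded by \<open>1\<close>; the others by
  \<open>inverse_sin_le\<close>, which produces two harmonic sums, one from each end.
\<close>

lemma sum_norm_digit_kernel_le:
  fixes p N :: nat
  assumes "p \<ge> 2" "N > 0"
  shows "(\<Sum>k<p. norm (digit_kernel N (t + 2 * pi * real k / real p))) \<le> 2 + 2 * real p / real N * (1 + ln (real p))"
proof -
  let ?G = "\<lambda>t. norm (digit_kernel N t)"
  obtain s where s: "0 \<le> s" "s < 2 * pi / p"
    and eq: "(\<Sum>k<p. ?G (t + 2 * pi * real k / real p)) = (\<Sum>k<p. ?G (s + 2 * pi * real k / real p))"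
    using sum_shift_periodic[of ?G "2 * pi" p t] assms by (auto simp: digit_kernel_periodic)
  obtain q where p: "p = Suc (Suc q)" using assms by (metis add_2_eq_Suc le_Suc_ex)
  have mid: "?G (s + 2 * pi * Suc k / p) \<le> p / N * (1 / Suc k + 1 / (q - k))" if "k < q" for k
  proof -
    define y where "y = (s + 2 * pi * Suc k / p) / 2"
    have pk: "pi * x \<ge> 3 * x" if "x \<ge> 0" for x :: real using that pi_gt3 by (intro mult_right_mono) auto
    have y: "y = s / 2 + pi * (Suc k / p)" by (simp add: y_def field_simps)
    have "y \<ge> 3 * (Suc k / p)" using pk[of "Suc k / p"] s unfolding y by simp
    moreover have "pi - y \<ge> 3 * ((q - k) / p)"
    proof -
      have e: "real (q - k) / p = (real p - (real k + 2)) / p" using that by (simp add: p of_nat_diff)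
      have "pi - y \<ge> pi * ((real p - (real k + 2)) / p)"
      proof -
        have "pi * ((real p - (real k + 2)) / p) = pi - pi / p - pi * (Suc k / p)"
          using assms by (simp add: field_simps)
        moreover have "s / 2 \<le> pi / p" using s by (simp add: mult.commute)
        ultimately show ?thesis unfolding y by linarith
      qed
      moreover have "3 * (real (q - k) / p) \<le> pi * (real (q - k) / p)" by (rule pk) simp
      ultimately show ?thesis unfolding e by linarith
    qed
    ultimately have sy: "sin y > 0" "1 / sin y \<le> 3 / (3 * (Suc k / p)) + 3 / (3 * ((q - k) / p))"
      using inverse_sin_le[of "3 * (Suc k / p)" y "3 * ((q - k) / p)"] that p by auto
    have "?G (2 * y) * (real N * sin y) \<le> 1"
      using norm_digit_kernel_mult_sin_le[of N "2 * y"] sy by simp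
    then have "?G (2 * y) \<le> 1 / N * (1 / sin y)"
      using sy assms by (simp add: field_simps)
    also have "\<dots> \<le> 1 / N * (3 / (3 * (Suc k / p)) + 3 / (3 * ((q - k) / p)))"
      by (intro mult_left_mono sy) auto
    also have "\<dots> = p / N * (1 / Suc k + 1 / (q - k))"
    proof -
      have "1 / real N * (3 / (3 * (a / real p)) + 3 / (3 * (c / real p))) = real p / real N * (1 / a + 1 / c)" for a c
        by (simp add: distrib_left)
      then show ?thesis .
    qed
    also have "2 * y = s + 2 * pi * Suc k / p" by (simp add: y_def)
    finally show ?thesis .
  qed
  have h1: "(\<Sum>k<q. 1 / real (Suc k)) = harm q"
    by (simp add: harm_altdef divide_inverse)
  have h2: "(\<Sum>k<q. 1 / real (q - k)) = harm q"
  proof -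
    have "(\<Sum>k<q. 1 / real (q - k)) = (\<Sum>k<q. 1 / real (Suc (q - Suc k)))"
      by (intro sum.cong refl) (metis Suc_diff_Suc lessThan_iff)
    also have "\<dots> = (\<Sum>k<q. 1 / real (Suc k))"
      by (rule sum.nat_diff_reindex)
    finally show ?thesis unfolding h1 .
  qed
  have hq: "harm q \<le> 1 + ln (real p)"
    using harm_mono[of q p, where 'a=real] harm_le_ln[of p] p by linarith
  have "(\<Sum>k<Suc (Suc q). F k) = F 0 + (\<Sum>k<q. F (Suc k)) + F (Suc q)" for F :: "nat \<Rightarrow> real"
    by (subst sum.lessThan_Suc, subst sum.lessThan_Suc_shift) simp
  from this[of "\<lambda>k. ?G (s + 2 * pi * real k / real p)", folded p]
  have "(\<Sum>k<p. ?G (s + 2 * pi * real k / real p)) =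
      ?G (s + 2 * pi * real 0 / real p) + (\<Sum>k<q. ?G (s + 2 * pi * Suc k / p)) + ?G (s + 2 * pi * Suc q / p)" .
  also have "\<dots> \<le> 1 + (\<Sum>k<q. p / N * (1 / Suc k + 1 / (q - k))) + 1"
    by (intro add_mono sum_mono mid norm_digit_kernel_le_1) auto
  also have "\<dots> = 2 + p / N * (2 * harm q)"
  proof -
    have "(\<Sum>k<q. p / N * (1 / Suc k + 1 / (q - k))) = p / N * (\<Sum>k<q. 1 / real (Suc k) + 1 / real (q - k))"
      by (rule sum_distrib_left[symmetric])
    also have "\<dots> = p / N * (2 * harm q)" unfolding sum.distrib h1 h2 by simp
    finally show ?thesis by simp
  qed
  also have "\<dots> \<le> 2 + real p / real N * (2 * (1 + ln (real p)))"
    by (intro add_mono mult_left_mono hq) auto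
  finally show ?thesis unfolding eq by (simp add: mult_ac)
qed

text \<open>
  Here \<open>\<surd>p = b\<^sup>5\<^sup>0\<^sup>0\<^sup>0\<close> and \<open>p/N = b\<^sup>4\<^sup>9\<^sup>9\<^sup>5\<close>, and \<open>ln b \<le> 4\<close>, so the left side is at most
  \<open>80004 b\<^sup>4\<^sup>9\<^sup>9\<^sup>5\<close>, while \<open>b\<^sup>5 \<ge> 100000\<close>.
\<close>

lemma kernel_sum_bound_lt_sqrt:
  fixes b :: nat
  assumes "10 \<le> b" "b \<le> 11"
  shows "2 + 2 * real (b ^ 10000) / real (b ^ 5005) * (1 + ln (real (b ^ 10000))) < sqrt (real (b ^ 10000))"
proof -
  have b: "real b \<ge> 10" "real b \<le> 11" using assms by simp_all
  have "2 ^ 4 \<le> exp (1::real) ^ 4"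
    using exp_ge_add_one_self[of 1] by (intro power_mono) auto
  also have "\<dots> = exp 4" by (simp add: exp_of_nat_mult[symmetric])
  finally have "real b \<le> exp 4" using b by simp
  then have "ln (real b) \<le> ln (exp 4)" using b by (subst ln_le_cancel_iff) auto
  then have "ln (real b) \<le> 4" by simp
  have ratio: "real (b ^ 10000) / real (b ^ 5005) = real b ^ 4995"
    using b power_diff[of "real b" 5005 10000] by simp
  have root: "sqrt (real (b ^ 10000)) = real b ^ 5000"
  proof -
    have "real (b ^ 10000) = (real b ^ 5000)\<^sup>2" by (simp add: power_mult[symmetric])
    then show ?thesis by (simp only: real_sqrt_abs) simp
  qed
  have "2 + 2 * real (b ^ 10000) / real (b ^ 5005) * (1 + ln (real (b ^ 10000)))
      = 2 + (real (b ^ 10000) / real (b ^ 5005)) * (2 * (1 + 10000 * ln (real b)))"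
    using b by (simp add: ln_realpow)
  also have "\<dots> = 2 + real b ^ 4995 * (2 * (1 + 10000 * ln (real b)))"
    by (simp only: ratio)
  also have "\<dots> \<le> 2 * real b ^ 4995 + real b ^ 4995 * (2 * (1 + 10000 * 4))"
    using b \<open>ln (real b) \<le> 4\<close> by (intro add_mono mult_left_mono) auto
  also have "\<dots> < real b ^ 4995 * 10 ^ 5" using b by simp
  also have "\<dots> \<le> real b ^ 4995 * real b ^ 5" using b by (intro mult_left_mono power_mono) auto
  also have "\<dots> = sqrt (real (b ^ 10000))" unfolding root by (simp add: power_add[symmetric])
  finally show ?thesis .
qed

section \<open>Self-similarity of missing digits measures\<close>

lemma char_distr_pair_add:
  fixes f :: "'a \<Rightarrow> real" and g :: "'b \<Rightarrow> real"
  assumes "prob_space A" "prob_space B"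
    and [measurable]: "f \<in> borel_measurable A" "g \<in> borel_measurable B"
  shows "char (distr (A \<Otimes>\<^sub>M B) borel (\<lambda>(a, b). f a + g b)) t =
    char (distr A borel f) t * char (distr B borel g) t"
proof -
  interpret A: prob_space A by fact
  interpret B: prob_space B by fact
  interpret P: pair_prob_space A B ..
  have "char (distr (A \<Otimes>\<^sub>M B) borel (\<lambda>(a, b). f a + g b)) t =
      (CLINT (a, b)|A \<Otimes>\<^sub>M B. iexp (t * f a) * iexp (t * g b))"
    unfolding char_def
    by (subst integral_distr)
       (auto simp: case_prod_beta' exp_add[symmetric] distrib_left mult_ac)
  also have "\<dots> = (CLINT a|A. CLINT b|B. iexp (t * f a) * iexp (t * g b))"
    by (rule P.integral_fst'[symmetric, where f="\<lambda>(a, b). iexp (t * f a) * iexp (t * g b)", simplified prod.case])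
       (intro P.P.integrable_const_bound[of _ 1], auto simp: norm_mult case_prod_beta' simp del: of_real_mult)
  also have "\<dots> = (CLINT a|A. iexp (t * f a)) * (CLINT b|B. iexp (t * g b))"
    by (simp only: integral_mult_right_zero integral_mult_left_zero)
  also have "\<dots> = char (distr A borel f) t * char (distr B borel g) t"
    unfolding char_def by (simp add: integral_distr)
  finally show ?thesis .
qed

lemma char_distr_scale:
  assumes "sets M = sets borel"
  shows "char (distr M borel (\<lambda>y. c * y)) t = char M (c * t)"
  using assms by (simp add: char_def integral_distr mult_ac cong: measurable_cong_sets)

context
  fixes p :: nat and D :: "nat set"
  assumes p: "p \<ge> 2" and D: "finite D" "D \<noteq> {}" "D \<subseteq> {..<p}"
begin

lemma AE_digits_in: "AE d in PiM UNIV (\<lambda>i::nat. measure_pmf (pmf_of_set D)). \<forall>i. d i \<in> D"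
  unfolding AE_all_countable
proof
  fix i :: nat
  show "AE d in PiM UNIV (\<lambda>i::nat. measure_pmf (pmf_of_set D)). d i \<in> D"
    by (rule AE_PiM_component[where P="\<lambda>x. x \<in> D"])
       (auto simp: prob_space_measure_pmf AE_measure_pmf_iff D)
qed

lemma digit_sum_case_nat:
  assumes "a \<in> D" "\<And>i. d i \<in> D"
  shows "digit_sum p (case_nat a d) = (1 / p) * real a + (1 / p) * digit_sum p d"
proof -
  have lt: "d i < p" for i using assms(2)[of i] D by auto
  have 1: "summable (\<lambda>i. real (case_nat a d i) / real p ^ Suc i)"
    using assms lt D p by (intro summable_digit_sum) (auto split: nat.split)
  have "digit_sum p (case_nat a d) = a / p + (\<Sum>i. real (d i) / real p ^ Suc (Suc i))"
    unfolding digit_sum_def using suminf_split_head[OF 1] by simp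
  also have "(\<Sum>i. real (d i) / real p ^ Suc (Suc i)) = (\<Sum>i. (1 / p) * (real (d i) / real p ^ Suc i))"
    by (simp add: mult_ac)
  also have "\<dots> = (1 / p) * digit_sum p d"
    unfolding digit_sum_def by (rule suminf_mult[OF summable_digit_sum[OF p lt]])
  finally show ?thesis by simp
qed

lemma digit_sum_bounds:
  assumes "\<And>i. d i \<in> D"
  shows "digit_sum p d \<in> {0..2}"
proof -
  have lt: "d i < p" for i using assms[of i] D by auto
  note s = summable_digit_sum[OF p lt]
  have g: "summable (\<lambda>i. (1 / real p) ^ i)" using p by (intro summable_geometric) auto
  have "digit_sum p d \<le> (\<Sum>i. (1 / real p) ^ i)"
    unfolding digit_sum_def
  proof (rule suminf_le[OF _ s g])
    fix i show "real (d i) / real p ^ Suc i \<le> (1 / real p) ^ i"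
      using p lt[of i] by (simp add: field_simps)
  qed
  also have "\<dots> = 1 / (1 - 1 / real p)" using p by (intro suminf_geometric) auto
  also have "\<dots> \<le> 2" using p by (simp add: field_simps)
  finally show ?thesis
    using suminf_nonneg[OF s] by (simp add: digit_sum_def)
qed

text \<open>
  Self-similarity: dropping the first digit of \<open>S = (d\<^sub>1 + S') / p\<close> leaves a copy \<open>S'\<close> of \<open>S\<close> that
  is independent of \<open>d\<^sub>1\<close>.
\<close>

lemma char_missing_digits_recursion:
  "char (missing_digits_measure p D) t =
    char (distr (measure_pmf (pmf_of_set D)) borel real) (t / p) * char (missing_digits_measure p D) (t / p)"
proof -
  let ?M = "measure_pmf (pmf_of_set D)"
  let ?S = "PiM UNIV (\<lambda>i::nat. ?M)"
  interpret sequence_space ?M ..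
  have [measurable]: "digit_sum p \<in> borel_measurable ?S" by (rule measurable_digit_sum)
  interpret P: pair_prob_space ?M ?S ..
  have ae: "AE z in ?M \<Otimes>\<^sub>M ?S. fst z \<in> D \<and> (\<forall>i. snd z i \<in> D)"
  proof (rule P.AE_pair_measure)
    show "{z \<in> space (?M \<Otimes>\<^sub>M ?S). fst z \<in> D \<and> (\<forall>i. snd z i \<in> D)} \<in> sets (?M \<Otimes>\<^sub>M ?S)"
      by measurable
    show "AE a in ?M. AE d in ?S. fst (a, d) \<in> D \<and> (\<forall>i. snd (a, d) i \<in> D)"
      using AE_digits_in D by (auto simp: AE_measure_pmf_iff)
  qed
  have "missing_digits_measure p D = distr (distr (?M \<Otimes>\<^sub>M ?S) ?S (\<lambda>(s, \<omega>). case_nat s \<omega>)) borel (digit_sum p)"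
    unfolding PiM_iter missing_digits_measure_def ..
  also have "\<dots> = distr (?M \<Otimes>\<^sub>M ?S) borel (\<lambda>z. digit_sum p (case_nat (fst z) (snd z)))"
    by (subst distr_distr) (auto simp: case_prod_beta' comp_def)
  also have "\<dots> = distr (?M \<Otimes>\<^sub>M ?S) borel (\<lambda>(a, d). (1 / p) * real a + (1 / p) * digit_sum p d)"
    by (intro distr_cong_AE refl eventually_mono[OF ae])
       (auto simp: case_prod_beta' digit_sum_case_nat)
  finally have "char (missing_digits_measure p D) t =
      char (distr ?M borel (\<lambda>a. (1 / p) * real a)) t * char (distr ?S borel (\<lambda>d. (1 / p) * digit_sum p d)) t"
    using char_distr_pair_add[of ?M ?S "\<lambda>a. (1 / p) * real a" "\<lambda>d. (1 / p) * digit_sum p d" t]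
    by (simp add: prob_space_measure_pmf prob_space_PiM)
  also have "distr ?M borel (\<lambda>a. (1 / p) * real a) = distr (distr ?M borel real) borel (\<lambda>y. (1 / p) * y)"
    by (subst distr_distr) (auto simp: comp_def)
  also have "distr ?S borel (\<lambda>d. (1 / p) * digit_sum p d) = distr (missing_digits_measure p D) borel (\<lambda>y. (1 / p) * y)"
    unfolding missing_digits_measure_def by (subst distr_distr) (auto simp: comp_def)
  finally show ?thesis
    by (simp only: char_distr_scale sets_distr missing_digits_measure_def) simp
qed

lemma AE_missing_digits_bounds: "AE y in missing_digits_measure p D. y \<in> {0..2}"
  unfolding missing_digits_measure_def
  by (subst AE_distr_iff)
     (auto intro!: measurable_digit_sum eventually_mono[OF AE_digits_in] digit_sum_bounds simp del: atLeastAtMost_iff)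

end

lemma char_uniform_digits:
  assumes "N > 0"
  shows "char (distr (measure_pmf (pmf_of_set {1..N})) borel real) t = digit_kernel N t"
proof -
  have "char (distr (measure_pmf (pmf_of_set {1..N})) borel real) t =
      (LINT d|measure_pmf (pmf_of_set {1..N}). iexp (t * real d))"
    by (simp add: char_def integral_distr)
  also have "\<dots> = (\<Sum>d=1..N. pmf (pmf_of_set {1..N}) d *\<^sub>R iexp (t * real d))"
    using assms by (intro integral_measure_pmf) auto
  also have "\<dots> = digit_kernel N t"
    using assms by (simp add: digit_kernel_def scaleR_conv_of_real sum_divide_distrib)
  finally show ?thesis .
qed

section \<open>Averages of self-similar functions\<close>

text \<open>
  For \<open>j = i p + k\<close> with \<open>k < p\<close>, the recursion bounds \<open>\<phi> (t + 2\<pi>j)\<close> by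
  \<open>g (u) \<phi> (u + 2\<pi>i)\<close> with \<open>u = (t + 2\<pi>k) / p\<close>, because \<open>g\<close> does not see the shift by \<open>2\<pi>i\<close>.
  The induction hypothesis handles the sum over \<open>i\<close> at the point \<open>u\<close>, and the remaining sum over
  \<open>k\<close> is at most \<open>B\<close>. The hypotheses must hold at every point since \<open>u\<close> changes with \<open>k\<close>.
\<close>

lemma sum_blocks_le_power:
  fixes \<phi> g :: "real \<Rightarrow> real" and p :: nat
  assumes nonneg: "\<And>t. 0 \<le> g t" and le1: "\<And>t. \<phi> t \<le> 1"
    and rec: "\<And>t. \<phi> t \<le> g (t / p) * \<phi> (t / p)"
    and per: "\<And>t i. g (t + 2 * pi * real i) = g t"
    and B: "\<And>t. (\<Sum>k<p. g (t + 2 * pi * real k / real p)) \<le> B" and p: "p > 0"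
  shows "(\<Sum>j<p ^ n. \<phi> (t + 2 * pi * real j)) \<le> B ^ n"
proof (induction n arbitrary: t)
  case 0
  then show ?case using le1[of t] by simp
next
  case (Suc n)
  have B0: "B \<ge> 0" using B[of 0] sum_nonneg[of "{..<p}" "\<lambda>k. g (0 + 2 * pi * real k / real p)"] nonneg by force
  let ?u = "\<lambda>k::nat. (t + 2 * pi * real k) / p"
  have "(\<Sum>j<p ^ Suc n. \<phi> (t + 2 * pi * real j)) = (\<Sum>i<p ^ n. \<Sum>j=i * p..<i * p + p. \<phi> (t + 2 * pi * real j))"
    by (subst sum.nat_group) (simp add: mult.commute)
  also have "\<dots> = (\<Sum>i<p ^ n. \<Sum>k<p. \<phi> (t + 2 * pi * real (i * p + k)))"
    by (subst sum.atLeastLessThan_shift_0) (simp add: atLeast0LessThan)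
  also have "\<dots> \<le> (\<Sum>i<p ^ n. \<Sum>k<p. g (?u k) * \<phi> (?u k + 2 * pi * real i))"
  proof (intro sum_mono)
    fix i k :: nat
    have "(t + 2 * pi * real (i * p + k)) / p = ?u k + 2 * pi * real i" using p by (simp add: field_simps)
    then show "\<phi> (t + 2 * pi * real (i * p + k)) \<le> g (?u k) * \<phi> (?u k + 2 * pi * real i)"
      using rec[of "t + 2 * pi * real (i * p + k)"] per[of "?u k" i] by simp
  qed
  also have "\<dots> = (\<Sum>k<p. g (?u k) * (\<Sum>i<p ^ n. \<phi> (?u k + 2 * pi * real i)))"
    by (subst sum.swap) (simp add: sum_distrib_left)
  also have "\<dots> \<le> (\<Sum>k<p. g (?u k) * B ^ n)"
    by (intro sum_mono mult_left_mono Suc.IH nonneg)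
  also have "\<dots> = (\<Sum>k<p. g (t / p + 2 * pi * real k / real p)) * B ^ n"
    by (simp add: sum_distrib_right add_divide_distrib)
  also have "\<dots> \<le> B * B ^ n"
    by (intro mult_right_mono B) (use B0 in auto)
  finally show ?case by simp
qed

lemma nn_integral_window:
  fixes \<phi> :: "real \<Rightarrow> real"
  assumes [measurable]: "\<phi> \<in> borel_measurable borel" and nonneg: "\<And>t. 0 \<le> \<phi> t" and "L > 0"
  shows "(\<integral>\<^sup>+x\<in>{c..<c + L * real m}. \<phi> x \<partial>lborel) =
    (\<integral>\<^sup>+x\<in>{c..<c + L}. (\<Sum>j<m. \<phi> (x + L * real j)) \<partial>lborel)"
proof (induction m)
  case (Suc m)
  have "(\<integral>\<^sup>+x\<in>{c..<c + L * real (Suc m)}. \<phi> x \<partial>lborel) =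
      (\<integral>\<^sup>+x. ennreal (\<phi> x) * indicator {c..<c + L * real m} x +
        ennreal (\<phi> x) * indicator {c + L * real m..<c + L * real (Suc m)} x \<partial>lborel)"
  proof (intro nn_integral_cong)
    fix x
    have "0 \<le> L * real m" using \<open>L > 0\<close> by simp
    then have "c \<le> x" if "c + L * real m \<le> x" using that by linarith
    then show "ennreal (\<phi> x) * indicator {c..<c + L * real (Suc m)} x =
        ennreal (\<phi> x) * indicator {c..<c + L * real m} x +
        ennreal (\<phi> x) * indicator {c + L * real m..<c + L * real (Suc m)} x"
      using \<open>L > 0\<close> by (auto simp: indicator_def distrib_left)
  qed
  also have "\<dots> = (\<integral>\<^sup>+x\<in>{c..<c + L * real m}. \<phi> x \<partial>lborel) +
      (\<integral>\<^sup>+x\<in>{c + L * real m..<c + L * real (Suc m)}. \<phi> x \<partial>lborel)"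
    by (intro nn_integral_add) auto
  also have "(\<integral>\<^sup>+x\<in>{c + L * real m..<c + L * real (Suc m)}. \<phi> x \<partial>lborel) =
      (\<integral>\<^sup>+x\<in>{c..<c + L}. \<phi> (x + L * m) \<partial>lborel)"
    by (subst nn_integral_real_affine[where c=1 and t="L * m"])
       (auto intro!: nn_integral_cong simp: indicator_def algebra_simps)
  also have "(\<integral>\<^sup>+x\<in>{c..<c + L * real m}. \<phi> x \<partial>lborel) + \<dots> =
     (\<integral>\<^sup>+x\<in>{c..<c + L}. (\<Sum>j<Suc m. \<phi> (x + L * real j)) \<partial>lborel)"
    unfolding Suc.IH
    by (subst nn_integral_add[symmetric])
       (auto intro!: nn_integral_cong simp: nonneg sum_nonneg indicator_def)
  finally show ?case .
qed (use \<open>L > 0\<close> in \<open>simp add: indicator_def\<close>)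

text \<open>
  The length \<open>2R\<close> is less than \<open>2\<pi>p\<^sup>n\<close>, so the interval fits into \<open>p\<^sup>n\<close> consecutive periods.
\<close>

lemma nn_integral_window_le:
  fixes \<phi> :: "real \<Rightarrow> real" and p :: nat and R :: real
  assumes [measurable]: "\<phi> \<in> borel_measurable borel" and nonneg: "\<And>t. 0 \<le> \<phi> t"
    and blocks: "\<And>n t. (\<Sum>j<p ^ n. \<phi> (t + 2 * pi * real j)) \<le> B ^ n" and p: "p > 0" and R: "0 \<le> R" "R \<le> p ^ n"
  shows "(\<integral>\<^sup>+x\<in>{-R..R}. \<phi> x \<partial>lborel) \<le> ennreal (2 * pi * B ^ n)"
proof -
  have "R < 2 * pi * p ^ n - R"
  proof -
    have "real (p ^ n) * 1 < real (p ^ n) * pi" using pi_gt3 p by (intro mult_strict_left_mono) auto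
    then show ?thesis using R by (simp add: mult.commute)
  qed
  then have "(\<integral>\<^sup>+x\<in>{-R..R}. \<phi> x \<partial>lborel) \<le> (\<integral>\<^sup>+x\<in>{-R..<-R + 2 * pi * real (p ^ n)}. \<phi> x \<partial>lborel)"
    by (intro nn_integral_mono) (auto simp: indicator_def)
  also have "\<dots> = (\<integral>\<^sup>+x\<in>{-R..<-R + 2 * pi}. (\<Sum>j<p ^ n. \<phi> (x + 2 * pi * real j)) \<partial>lborel)"
    by (rule nn_integral_window) (auto simp: nonneg)
  also have "\<dots> \<le> (\<integral>\<^sup>+x\<in>{-R..<-R + 2 * pi}. ennreal (B ^ n) \<partial>lborel)"
    by (intro nn_integral_mono mult_right_mono ennreal_leI blocks) auto
  also have "\<dots> = ennreal (2 * pi * B ^ n)"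
    by (simp add: nn_integral_cmult_indicator ennreal_mult'[symmetric] mult.commute ennreal_mult'')
  finally show ?thesis .
qed

text \<open>
  Rounding \<open>R\<close> up to the next power of \<open>p\<close> costs at most a factor \<open>p\<close> in \<open>R\<close>, hence \<open>\<surd>p\<close> in the bound.
\<close>

lemma nn_integral_window_sqrt:
  fixes f :: "real \<Rightarrow> ennreal" and p :: nat and R :: real
  assumes win: "\<And>n (R::real). 0 \<le> R \<Longrightarrow> R \<le> p ^ n \<Longrightarrow> (\<integral>\<^sup>+x\<in>{-R..R}. f x \<partial>lborel) \<le> ennreal (K * B ^ n)"
    and "p > 1" "0 \<le> B" "B \<le> sqrt p" "1 \<le> R" "0 \<le> K"
  shows "(\<integral>\<^sup>+x\<in>{-R..R}. f x \<partial>lborel) \<le> ennreal (K * sqrt p * sqrt R)"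
proof -
  have "\<exists>n. R \<le> p ^ n" using real_arch_pow[of p R] assms by (auto intro: less_imp_le)
  define n where "n = (LEAST n. R \<le> p ^ n)"
  have n: "R \<le> p ^ n" unfolding n_def using \<open>\<exists>n. R \<le> p ^ n\<close> by (rule LeastI_ex)
  have "B ^ n \<le> sqrt p * sqrt R"
  proof (cases n)
    case 0
    have "1 * 1 \<le> sqrt p * sqrt R" using assms by (intro mult_mono) auto
    then show ?thesis using 0 by simp
  next
    case (Suc k)
    have "\<not> R \<le> p ^ k" using not_less_Least[of k "\<lambda>n. R \<le> p ^ n"] Suc by (simp add: n_def)
    then have "sqrt (p ^ k) \<le> sqrt R" by simp
    then have "sqrt p ^ k \<le> sqrt R" by (simp add: real_sqrt_power)
    moreover have "B ^ n \<le> sqrt p ^ n" using assms by (intro power_mono) auto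
    ultimately show ?thesis using Suc mult_left_mono[of "sqrt p ^ k" "sqrt R" "sqrt p"] by simp
  qed
  then have "K * B ^ n \<le> K * sqrt p * sqrt R" using assms by (simp add: mult_left_mono mult.assoc)
  then show ?thesis using win[OF _ n] assms by (meson ennreal_leI order_trans zero_le_one)
qed

text \<open>
  Averaging over \<open>\<bar>x\<bar> \<le> m\<close> is a change of variable in \<open>g\<close> alone: the integral of \<open>g (x t)\<close> is
  \<open>O(\<bar>t\<bar>\<^sup>-\<^sup>1\<^sup>/\<^sup>2)\<close> by the square-root growth of its integrals. The strict inequality
  \<open>B < \<surd>p\<close> then makes the \<open>p\<close>-adic pieces of the integral of \<open>f\<close> against \<open>\<bar>t\<bar>\<^sup>-\<^sup>1\<^sup>/\<^sup>2\<close> summable.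
\<close>

lemma AE_finite_nn_integral_scaled_product:
  fixes f g :: "real \<Rightarrow> ennreal" and p :: nat
  assumes [measurable]: "f \<in> borel_measurable borel" "g \<in> borel_measurable borel"
    and g1: "\<And>t. g t \<le> 1"
    and f: "\<And>n. (\<integral>\<^sup>+x\<in>{-(real p ^ n)..real p ^ n}. f x \<partial>lborel) \<le> ennreal (K * B ^ n)"
    and g: "\<And>R. 1 \<le> R \<Longrightarrow> (\<integral>\<^sup>+x\<in>{-R..R}. g x \<partial>lborel) \<le> ennreal (C * sqrt R)"
    and "p > 1" "0 \<le> B" "B < sqrt p" "0 \<le> K" "0 \<le> C"
  shows "AE x in lborel. (\<integral>\<^sup>+t. f t * g (x * t) \<partial>lborel) < \<infinity>"
proof -
  have loc: "(\<integral>\<^sup>+x\<in>{-real m..real m}. (\<integral>\<^sup>+t. f t * g (x * t) \<partial>lborel) \<partial>lborel) < \<infinity>" if "m > 0" for m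
  proof -
    define I where "I t = (\<integral>\<^sup>+x\<in>{-real m..real m}. g (x * t) \<partial>lborel)" for t
    have I1: "I t \<le> ennreal (2 * m)" for t
    proof -
      have "I t \<le> (\<integral>\<^sup>+x\<in>{-real m..real m}. 1 \<partial>lborel)"
        unfolding I_def by (intro nn_integral_mono mult_right_mono g1) auto
      then show ?thesis by simp
    qed
    have I2: "I t \<le> ennreal (C * sqrt m / sqrt \<bar>t\<bar>)" if "\<bar>t\<bar> \<ge> 1" for t
    proof -
      define R where "R = m * \<bar>t\<bar>"
      have "1 * 1 \<le> m * \<bar>t\<bar>" using that \<open>m > 0\<close> by (intro mult_mono) auto
      then have "1 \<le> R" by (simp add: R_def)
      have iv: "y \<in> {-r..r} \<longleftrightarrow> \<bar>y\<bar> \<le> r" for y r :: real by auto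
      have cancel: "\<bar>x * t\<bar> \<le> R \<longleftrightarrow> \<bar>x\<bar> \<le> m" for x
        unfolding R_def abs_mult by (rule mult_le_cancel_right_pos) (use that in simp)
      have ind: "(x * t \<in> {-R..R}) \<longleftrightarrow> (x \<in> {-real m..real m})" for x
        unfolding iv by (rule cancel)
      have "(\<integral>\<^sup>+x\<in>{-R..R}. g x \<partial>lborel) = \<bar>t\<bar> * (\<integral>\<^sup>+x. g (0 + t * x) * indicator {-R..R} (0 + t * x) \<partial>lborel)"
        using that by (subst nn_integral_real_affine[where c=t and t=0]) auto
      also have "(\<integral>\<^sup>+x. g (0 + t * x) * indicator {-R..R} (0 + t * x) \<partial>lborel) = I t"
        unfolding I_def using ind by (intro nn_integral_cong) (auto simp: indicator_def mult.commute)
      finally have "ennreal \<bar>t\<bar> * I t \<le> ennreal (C * sqrt R)"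
        using g[OF \<open>1 \<le> R\<close>] by simp
      then have "ennreal (1 / \<bar>t\<bar>) * (ennreal \<bar>t\<bar> * I t) \<le> ennreal (1 / \<bar>t\<bar>) * ennreal (C * sqrt R)"
        by (rule mult_left_mono) simp
      also have "ennreal (1 / \<bar>t\<bar>) * (ennreal \<bar>t\<bar> * I t) = I t"
        using that by (simp add: mult.assoc[symmetric] ennreal_mult'[symmetric])
      also have "ennreal (1 / \<bar>t\<bar>) * ennreal (C * sqrt R) = ennreal (C * sqrt m / sqrt \<bar>t\<bar>)"
      proof -
        have "1 / \<bar>t\<bar> * (C * sqrt R) = C * sqrt m * (sqrt \<bar>t\<bar> / \<bar>t\<bar>)"
          by (simp add: R_def real_sqrt_mult)
        also have "sqrt \<bar>t\<bar> / \<bar>t\<bar> = inverse (sqrt \<bar>t\<bar>)"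
          by (rule sqrt_divide_self_eq) simp
        finally have "1 / \<bar>t\<bar> * (C * sqrt R) = C * sqrt m / sqrt \<bar>t\<bar>"
          by (simp only: divide_inverse)
        then show ?thesis by (simp add: ennreal_mult'[symmetric])
      qed
      finally show ?thesis .
    qed
    define A where "A = 2 * m + C * sqrt m"
    have A: "A \<ge> 0" "2 * m \<le> A" "C * sqrt m \<le> A" using assms by (simp_all add: A_def)
    let ?J = "\<lambda>n. {-(real p ^ Suc n)..real p ^ Suc n}"
    have single: "F n \<le> (\<Sum>n. F n)" for F :: "nat \<Rightarrow> ennreal" and n
      using sum_le_suminf[of F "{n}"] by simp
    \<comment> \<open>A step function above a multiple of \<open>min 1 (\<bar>t\<bar>\<^sup>-\<^sup>1\<^sup>/\<^sup>2)\<close>: the term of the shell containing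
      \<open>t\<close> already suffices, and the full symmetric intervals are the sets on which \<open>f\<close> is controlled.\<close>
    have I: "I t \<le> (\<Sum>n. ennreal (A * (1 / sqrt p) ^ n) * indicator (?J n) t)" for t
    proof -
      have "\<exists>n. I t \<le> ennreal (A * (1 / sqrt p) ^ n) * indicator (?J n) t"
      proof (cases "\<bar>t\<bar> \<ge> 1")
        case False
        then have "t \<in> ?J 0" using \<open>p > 1\<close> by auto
        moreover have "I t \<le> ennreal A" using I1[of t] A ennreal_leI order.trans by blast
        ultimately show ?thesis by (intro exI[of _ 0]) simp
      next
        case True
        have "\<exists>n. \<bar>t\<bar> < p ^ n" using real_arch_pow[of p "\<bar>t\<bar>"] assms by auto
        define k where "k = (LEAST n. \<bar>t\<bar> < p ^ n)"
        have k: "\<bar>t\<bar> < p ^ k" unfolding k_def using \<open>\<exists>n. \<bar>t\<bar> < p ^ n\<close> by (rule LeastI_ex)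
        with True obtain n where n: "k = Suc n" by (cases k) auto
        have "\<not> \<bar>t\<bar> < p ^ n" using not_less_Least[of n "\<lambda>n. \<bar>t\<bar> < p ^ n"] n by (simp add: k_def)
        then have "sqrt (real p ^ n) \<le> sqrt \<bar>t\<bar>" by simp
        then have le: "sqrt p ^ n \<le> sqrt \<bar>t\<bar>" by (simp add: real_sqrt_power)
        have "C * sqrt m / sqrt \<bar>t\<bar> \<le> A / sqrt p ^ n"
          using le A assms by (intro frac_le) auto
        then have "I t \<le> ennreal (A * (1 / sqrt p) ^ n)"
          using I2[OF True] by (simp add: power_divide) (meson ennreal_leI order.trans)
        moreover have "t \<in> ?J n" using k n by auto
        ultimately show ?thesis by (intro exI[of _ n]) simp
      qed
      then obtain n where "I t \<le> ennreal (A * (1 / sqrt p) ^ n) * indicator (?J n) t" ..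
      also have "\<dots> \<le> (\<Sum>n. ennreal (A * (1 / sqrt p) ^ n) * indicator (?J n) t)"
        by (rule single)
      finally show ?thesis .
    qed
    have "(\<integral>\<^sup>+x\<in>{-real m..real m}. (\<integral>\<^sup>+t. f t * g (x * t) \<partial>lborel) \<partial>lborel) =
      (\<integral>\<^sup>+x. (\<integral>\<^sup>+t. f t * g (x * t) * indicator {-real m..real m} x \<partial>lborel) \<partial>lborel)"
      by (intro nn_integral_cong nn_integral_multc[symmetric]) measurable
    also have "\<dots> = (\<integral>\<^sup>+t. (\<integral>\<^sup>+x. f t * g (x * t) * indicator {-real m..real m} x \<partial>lborel) \<partial>lborel)"
      by (rule lborel_pair.Fubini') measurable
    also have "\<dots> = (\<integral>\<^sup>+t. f t * I t \<partial>lborel)"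
      unfolding I_def mult.assoc by (intro nn_integral_cong nn_integral_cmult) measurable
    also have "\<dots> \<le> (\<integral>\<^sup>+t. f t * (\<Sum>n. ennreal (A * (1 / sqrt p) ^ n) * indicator (?J n) t) \<partial>lborel)"
      by (intro nn_integral_mono mult_left_mono I) auto
    also have "\<dots> = (\<integral>\<^sup>+t. (\<Sum>n. ennreal (A * (1 / sqrt p) ^ n) * (f t * indicator (?J n) t)) \<partial>lborel)"
      by (intro nn_integral_cong, subst ennreal_suminf_cmult[symmetric]) (simp only: mult_ac)
    also have "\<dots> = (\<Sum>n. \<integral>\<^sup>+t. ennreal (A * (1 / sqrt p) ^ n) * (f t * indicator (?J n) t) \<partial>lborel)"
      by (rule nn_integral_suminf) measurable
    also have "\<dots> = (\<Sum>n. ennreal (A * (1 / sqrt p) ^ n) * (\<integral>\<^sup>+t\<in>?J n. f t \<partial>lborel))"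
      by (intro suminf_cong nn_integral_cmult) measurable
    also have "\<dots> \<le> (\<Sum>n. ennreal (A * (1 / sqrt p) ^ n) * ennreal (K * B ^ Suc n))"
      by (intro suminf_le mult_left_mono f) auto
    also have "\<dots> = (\<Sum>n. ennreal (A * K * B * (B / sqrt p) ^ n))"
    proof (intro suminf_cong)
      fix n
      have "A * (1 / sqrt p) ^ n * (K * B ^ Suc n) = A * K * B * (B / sqrt p) ^ n"
        by (simp add: power_divide)
      moreover have "0 \<le> A * (1 / sqrt p) ^ n" "0 \<le> K * B ^ Suc n" using A assms by simp_all
      ultimately show "ennreal (A * (1 / sqrt p) ^ n) * ennreal (K * B ^ Suc n) = ennreal (A * K * B * (B / sqrt p) ^ n)"
        by (simp only: ennreal_mult[symmetric])
    qed
    also have "\<dots> = ennreal (\<Sum>n. A * K * B * (B / sqrt p) ^ n)"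
    proof (rule suminf_ennreal2)
      have "norm (B / sqrt p) < 1" using assms by simp
      then show "summable (\<lambda>n. A * K * B * (B / sqrt p) ^ n)"
        by (intro summable_mult summable_geometric)
      show "0 \<le> A * K * B * (B / sqrt p) ^ n" for n
        using A assms by simp
    qed
    also have "\<dots> < \<infinity>" by simp
    finally show ?thesis .
  qed
  have "AE x in lborel. \<forall>m. (\<integral>\<^sup>+t. f t * g (x * t) \<partial>lborel) * indicator {-real (Suc m)..real (Suc m)} x \<noteq> \<infinity>"
    unfolding AE_all_countable
  proof
    fix m
    show "AE x in lborel. (\<integral>\<^sup>+t. f t * g (x * t) \<partial>lborel) * indicator {-real (Suc m)..real (Suc m)} x \<noteq> \<infinity>"
      by (rule nn_integral_noteq_infinite[OF _ less_imp_neq[OF loc[OF zero_less_Suc]]]) measurable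
  qed
  then show ?thesis
  proof eventually_elim
    fix x assume *: "\<forall>m. (\<integral>\<^sup>+t. f t * g (x * t) \<partial>lborel) * indicator {-real (Suc m)..real (Suc m)} x \<noteq> \<infinity>"
    obtain m where "\<bar>x\<bar> \<le> real m" using real_arch_simple by blast
    then have "x \<in> {-real (Suc m)..real (Suc m)}" by auto
    then have "(\<integral>\<^sup>+t. f t * g (x * t) \<partial>lborel) \<noteq> \<infinity>"
      using *[rule_format, of m] by (simp only: indicator_simps mult_1_right not_False_eq_True)
    then show "(\<integral>\<^sup>+t. f t * g (x * t) \<partial>lborel) < \<infinity>"
      by (simp add: less_top)
  qed
qed

lemma char_missing_digits_window:
  fixes p N :: nat and R :: real
  defines "B \<equiv> 2 + 2 * real p / real N * (1 + ln (real p))"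
  assumes p: "p \<ge> 2" "0 < N" "N < p" and R: "0 \<le> R" "R \<le> p ^ n"
  shows "(\<integral>\<^sup>+t\<in>{-R..R}. norm (char (missing_digits_measure p {1..N}) t) \<partial>lborel) \<le> ennreal (2 * pi * B ^ n)"
proof (rule nn_integral_window_le[OF _ _ _ _ R])
  let ?\<mu> = "missing_digits_measure p {1..N}"
  interpret prob_space ?\<mu> by (rule prob_space_missing_digits_measure)
  interpret real_distribution ?\<mu> by unfold_locales (simp_all add: missing_digits_measure_def)
  show "(\<lambda>t. norm (char ?\<mu> t)) \<in> borel_measurable borel" by measurable
  have dig: "finite {1..N}" "{1..N} \<noteq> {}" "{1..N} \<subseteq> {..<p}" using p by auto
  show "(\<Sum>j<p ^ n. norm (char ?\<mu> (t + 2 * pi * real j))) \<le> B ^ n" for n t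
  proof (rule sum_blocks_le_power[where g = "\<lambda>t. norm (digit_kernel N t)"])
    show "norm (char ?\<mu> t) \<le> norm (digit_kernel N (t / p)) * norm (char ?\<mu> (t / p))" for t
      using char_missing_digits_recursion[OF p(1) dig, of t] char_uniform_digits[OF p(2)]
      by (simp add: norm_mult)
    show "norm (digit_kernel N (t + 2 * pi * real i)) = norm (digit_kernel N t)" for t i
      using digit_kernel.plus_of_nat[of N t i] by (simp add: mult_ac)
    show "(\<Sum>k<p. norm (digit_kernel N (t + 2 * pi * real k / real p))) \<le> B" for t
      unfolding B_def by (rule sum_norm_digit_kernel_le[OF p(1,2)])
  qed (use p cmod_char_le_1 in auto)
qed (use p in auto)

section \<open>Supports of measures\<close>

lemma closed_measure_supp: "closed (measure_supp M)"
proof -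
  have "- measure_supp M = \<Union>{U. open U \<and> emeasure M U = 0}"
    by (auto simp: measure_supp_def zero_less_iff_neq_zero)
  then show ?thesis by (simp add: closed_def open_Union)
qed

text \<open>
  The complement of the support is the union of all null open sets; by Lindelof countably many of
  them suffice.
\<close>

lemma AE_in_measure_supp:
  fixes M :: "'a::second_countable_topology measure"
  assumes "sets M = sets borel"
  shows "AE x in M. x \<in> measure_supp M"
proof -
  let ?F = "{U. open U \<and> emeasure M U = 0}"
  obtain G where G: "G \<subseteq> ?F" "countable G" "\<Union>G = \<Union>?F"
    using Lindelof[of ?F] by auto
  have "\<Union>G \<in> null_sets M"
    by (rule null_sets_UN'[where I=G and N=id, simplified])
       (use G assms in \<open>auto simp: null_sets_def\<close>)
  moreover have "- measure_supp M = \<Union>?F"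
    by (auto simp: measure_supp_def zero_less_iff_neq_zero)
  ultimately show ?thesis
    using G by (intro AE_I'[of "\<Union>G"]) auto
qed

lemma compact_measure_supp:
  fixes M :: "real measure"
  assumes "sets M = sets borel" "AE y in M. y \<in> {a..b}"
  shows "compact (measure_supp M)"
proof -
  have "measure_supp M \<subseteq> {a..b}"
  proof
    fix x assume x: "x \<in> measure_supp M"
    have "emeasure M (- {a..b}) = 0"
      using assms(2) by (subst (asm) AE_iff_measurable[where N="- {a..b}"]) (auto simp: assms sets_eq_imp_space_eq)
    moreover have "open (- {a..b})" by auto
    ultimately show "x \<in> {a..b}" using x by (force simp: measure_supp_def)
  qed
  then show ?thesis
    using closed_measure_supp by (metis bounded_closed_interval bounded_subset cbox_interval compact_eq_bounded_closed)
qed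

section \<open>Laws with integrable characteristic function\<close>

definition inverse_fourier :: "(real \<Rightarrow> complex) \<Rightarrow> real \<Rightarrow> complex" where
  "inverse_fourier \<phi> x = 1 / (2 * pi) * (CLBINT t. iexp (- (t * x)) * \<phi> t)"

lemma integrable_iexp_mult:
  assumes "integrable lborel \<phi>"
  shows "integrable lborel (\<lambda>t. iexp (- (t * x)) * \<phi> t)"
  using assms borel_measurable_integrable[OF assms]
  by (intro Bochner_Integration.integrable_bound[OF assms])
     (auto simp: norm_mult simp del: of_real_minus of_real_mult)

lemma continuous_inverse_fourier:
  assumes "integrable lborel \<phi>"
  shows "isCont (inverse_fourier \<phi>) x"
  unfolding continuous_at_sequentially
proof safe
  fix X assume X: "X \<longlonglongrightarrow> x"
  have "(\<lambda>n. CLBINT t. iexp (- (t * X n)) * \<phi> t) \<longlonglongrightarrow> (CLBINT t. iexp (- (t * x)) * \<phi> t)"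
    by (rule integral_dominated_convergence[where w="\<lambda>t. norm (\<phi> t)"])
       (use borel_measurable_integrable[OF assms] assms in
         \<open>auto intro!: tendsto_intros X AE_I2 simp: norm_mult simp del: of_real_minus of_real_mult\<close>)
  then show "(inverse_fourier \<phi> \<circ> X) \<longlonglongrightarrow> inverse_fourier \<phi> x"
    unfolding inverse_fourier_def comp_def by (intro tendsto_intros)
qed

lemma interval_integral_iexp_scale:
  fixes t :: real
  assumes "a \<le> b" "t \<noteq> 0"
  shows "(CLBINT x=a..b. iexp (- (t * x))) = (iexp (- (t * a)) - iexp (- (t * b))) / (\<i> * t)"
proof -
  have "(CLBINT x=a..b. iexp (- (t * x))) = 
     (- iexp (- (t * b)) / (\<i> * t)) - (- iexp (- (t * a)) / (\<i> * t))"
    by (rule interval_integral_FTC_finite)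
       (use assms in \<open>auto intro!: continuous_intros derivative_eq_intros simp: has_vector_derivative_complex_iff Re_exp Im_exp Re_divide Im_divide power2_eq_square\<close>)
  then show ?thesis using assms by (simp add: diff_divide_distrib)
qed

text \<open>
  Fubini: integrating the oscillation \<open>e\<^sup>-\<^sup>i\<^sup>t\<^sup>x\<close> over \<open>x\<close> first produces the kernel of Levy's
  inversion formula.
\<close>

lemma interval_integral_inverse_fourier:
  assumes \<phi>: "integrable lborel \<phi>" and "a \<le> b"
  shows "(CLBINT x=a..b. inverse_fourier \<phi> x) =
    1 / (2 * pi) * (CLBINT t. (iexp (- (t * a)) - iexp (- (t * b))) / (\<i> * t) * \<phi> t)"
proof -
  note [measurable] = borel_measurable_integrable[OF \<phi>]
  let ?F = "\<lambda>x t. indicator {a<..<b} x *\<^sub>R (iexp (- (t * x)) * \<phi> t)"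
  have int: "integrable (lborel \<Otimes>\<^sub>M lborel) (\<lambda>(x, t). ?F x t)"
  proof (rule lborel_pair.Fubini_integrable)
    have "(\<lambda>x. LBINT t. norm (?F x t)) = (\<lambda>x. indicator {a<..<b} x * (LBINT t. norm (\<phi> t)))"
      by (auto simp: indicator_def norm_mult simp del: of_real_minus of_real_mult)
    moreover have "integrable lborel (\<lambda>x. indicator {a<..<b} x * (LBINT t. norm (\<phi> t)))"
      using assms by (intro integrable_mult_left integrable_real_indicator) auto
    ultimately show "integrable lborel (\<lambda>x. LBINT t. norm (case (x, t) of (x, t) \<Rightarrow> ?F x t))" by simp
    show "AE x in lborel. integrable lborel (\<lambda>t. case (x, t) of (x, t) \<Rightarrow> ?F x t)"
      using integrable_iexp_mult[OF \<phi>] by simp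
  qed measurable
  have "(CLBINT x=a..b. (CLBINT t. iexp (- (t * x)) * \<phi> t)) = (CLBINT x. (CLBINT t. ?F x t))"
    using assms by (simp add: interval_lebesgue_integral_def set_lebesgue_integral_def einterval_eq)
  also have "\<dots> = (CLBINT t. (CLBINT x. ?F x t))"
    using lborel_pair.Fubini_integral[OF int] by simp
  also have "\<dots> = (CLBINT t. (iexp (- (t * a)) - iexp (- (t * b))) / (\<i> * t) * \<phi> t)"
  proof (intro integral_cong_AE eventually_mono[OF AE_lborel_singleton[of 0]])
    fix t :: real
    assume "t \<noteq> 0"
    have "(CLBINT x. ?F x t) = (CLBINT x. (indicator {a<..<b} x *\<^sub>R iexp (- (t * x))) * \<phi> t)" by simp
    also have "\<dots> = (CLBINT x=a..b. iexp (- (t * x))) * \<phi> t"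
      unfolding integral_mult_left_zero
      using assms by (simp add: interval_lebesgue_integral_def set_lebesgue_integral_def einterval_eq)
    finally show "(CLBINT x. ?F x t) = (iexp (- (t * a)) - iexp (- (t * b))) / (\<i> * t) * \<phi> t"
      unfolding interval_integral_iexp_scale[OF \<open>a \<le> b\<close> \<open>t \<noteq> 0\<close>] .
  qed measurable
  finally show ?thesis
    unfolding inverse_fourier_def by (simp add: interval_lebesgue_integral_mult_right)
qed

lemma continuous_on_inverse_fourier: "integrable lborel \<phi> \<Longrightarrow> continuous_on A (inverse_fourier \<phi>)"
  by (intro continuous_at_imp_continuous_on ballI continuous_inverse_fourier)

lemma integral_inverse_fourier:
  assumes "integrable lborel \<phi>" and "a \<le> b"
  shows "integral {a..b} (inverse_fourier \<phi>) =
    1 / (2 * pi) * (CLBINT t. (iexp (- (t * a)) - iexp (- (t * b))) / (\<i> * t) * \<phi> t)"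
  unfolding interval_integral_inverse_fourier[OF assms, symmetric]
  by (intro interval_integral_eq_integral[symmetric] borel_integrable_atLeastAtMost'
       continuous_on_inverse_fourier assms)

lemma norm_inverse_fourier_le: "norm (inverse_fourier \<phi> x) \<le> (LBINT t. norm (\<phi> t))"
proof -
  have "norm (CLBINT t. iexp (- (t * x)) * \<phi> t) \<le> (LBINT t. norm (iexp (- (t * x)) * \<phi> t))"
    by (rule integral_norm_bound)
  also have "\<dots> = (LBINT t. norm (\<phi> t))"
    by (simp add: norm_mult del: of_real_minus of_real_mult)
  finally have *: "norm (CLBINT t. iexp (- (t * x)) * \<phi> t) \<le> (LBINT t. norm (\<phi> t))" .
  have "norm (inverse_fourier \<phi> x) = 1 / (2 * pi) * norm (CLBINT t. iexp (- (t * x)) * \<phi> t)"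
    by (simp add: inverse_fourier_def norm_mult norm_divide)
  also have "\<dots> \<le> 1 * norm (CLBINT t. iexp (- (t * x)) * \<phi> t)"
    using pi_gt3 by (intro mult_right_mono) auto
  finally show ?thesis using * by simp
qed

context real_distribution
begin

text \<open>
  Levy's inversion formula, whose truncated integrals converge by dominated convergence: the kernel
  is bounded by \<open>b - a\<close>.
\<close>

lemma measure_Ioc_inverse_fourier_continuity_points:
  assumes \<phi>: "integrable lborel (char M)" and "a \<le> b" and "measure M {a} = 0" "measure M {b} = 0"
  shows "complex_of_real (measure M {a<..b}) = integral {a..b} (inverse_fourier (char M))"
proof -
  note [measurable] = borel_measurable_integrable[OF \<phi>]
  let ?F = "\<lambda>t. (iexp (- (t * a)) - iexp (- (t * b))) / (\<i> * t) * char M t"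
  have bound: "norm (?F t) \<le> (b - a) * norm (char M t)" for t
  proof (cases "t = 0")
    case False
    have "norm ((iexp (- (t * a)) - iexp (- (t * b))) / (\<i> * t)) \<le> b - a"
      using Levy_Inversion_aux2[of "-b" "-a" t] False \<open>a \<le> b\<close> by simp
    then show ?thesis unfolding norm_mult by (rule mult_right_mono) simp
  qed (use \<open>a \<le> b\<close> in simp)
  have "(\<lambda>n. CLBINT t=-real n..real n. ?F t) \<longlonglongrightarrow> (CLBINT t. ?F t)"
  proof -
    have "(\<lambda>n. CLBINT t. indicator {-real n<..<real n} t *\<^sub>R ?F t) \<longlonglongrightarrow> (CLBINT t. ?F t)"
    proof (rule integral_dominated_convergence[where w="\<lambda>t. (b - a) * norm (char M t)"])
      show "AE t in lborel. (\<lambda>n. indicator {-real n<..<real n} t *\<^sub>R ?F t) \<longlonglongrightarrow> ?F t"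
      proof (rule AE_I2)
        fix t
        obtain N where "\<bar>t\<bar> < real N" using reals_Archimedean2 by blast
        have "\<forall>\<^sub>F n in sequentially. indicator {-real n<..<real n} t *\<^sub>R ?F t = ?F t"
        proof (rule eventually_mono[OF eventually_ge_at_top[of N]])
          fix n assume "N \<le> n"
          then have "real N \<le> real n" by simp
          with \<open>\<bar>t\<bar> < real N\<close> have "-real n < t" "t < real n" by linarith+
          then have "indicator {-real n<..<real n} t = (1::real)" by (simp only: indicator_def greaterThanLessThan_iff) simp
          then show "indicator {-real n<..<real n} t *\<^sub>R ?F t = ?F t" by (simp only: scaleR_one)
        qed
        then show "(\<lambda>n. indicator {-real n<..<real n} t *\<^sub>R ?F t) \<longlonglongrightarrow> ?F t"
          by (rule tendsto_eventually)
      qed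
      show "AE t in lborel. norm (indicator {-real n<..<real n} t *\<^sub>R ?F t) \<le> (b - a) * norm (char M t)" for n
        by (rule AE_I2) (use bound \<open>a \<le> b\<close> in \<open>auto simp: indicator_def\<close>)
    qed (use \<phi> in auto)
    then show ?thesis
      by (simp add: interval_lebesgue_integral_def set_lebesgue_integral_def einterval_eq)
  qed
  then have "(\<lambda>n. 1 / (2 * pi) * (CLBINT t=-real n..real n. ?F t)) \<longlonglongrightarrow> 1 / (2 * pi) * (CLBINT t. ?F t)"
    by (intro tendsto_intros)
  moreover have "(\<lambda>n. 1 / (2 * pi) * (CLBINT t=-real n..real n. ?F t)) \<longlonglongrightarrow> measure M {a<..b}"
    using Levy_Inversion[OF assms(2-4)] by simp
  ultimately show ?thesis
    unfolding integral_inverse_fourier[OF \<phi> \<open>a \<le> b\<close>] by (rule LIMSEQ_unique[symmetric])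
qed

text \<open>
  Atoms are countably many, so \<open>x\<close> can be enclosed between arbitrarily close points that are not
  atoms; the mass in between is at most a constant times their distance. This frees the
  inversion formula from its condition on the end points.
\<close>

lemma no_atoms_if_integrable_char:
  assumes \<phi>: "integrable lborel (char M)"
  shows "measure M {x} = 0"
proof -
  define C where "C = (LBINT t. norm (char M t))"
  have C: "C \<ge> 0" unfolding C_def by simp
  have "measure M {x} \<le> 0 + e" if "e > 0" for e
  proof -
    define d where "d = e / (2 * (C + 1))"
    have d: "d > 0" "C * (2 * d) \<le> e"
      using that C by (auto simp: d_def field_simps)
    obtain a where a: "x - d < a" "a < x" "measure M {a} = 0"
      using open_minus_countable[OF countable_support, of "{x - d<..<x}"] d by auto
    obtain b where b: "x < b" "b < x + d" "measure M {b} = 0"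
      using open_minus_countable[OF countable_support, of "{x<..<x + d}"] d by auto
    have "measure M {x} \<le> measure M {a<..b}"
      using a b by (intro finite_measure_mono) auto
    also have "\<dots> = norm (integral {a..b} (inverse_fourier (char M)))"
      using measure_Ioc_inverse_fourier_continuity_points[OF \<phi>, of a b] a b
      by (metis abs_of_nonneg less_imp_le less_trans measure_nonneg norm_of_real)
    also have "\<dots> \<le> C * (b - a)"
      using a b unfolding C_def
      by (intro integral_bound continuous_on_inverse_fourier \<phi> norm_inverse_fourier_le) auto
    also have "\<dots> \<le> C * (2 * d)" using a b C by (intro mult_left_mono) auto
    finally show ?thesis using d by simp
  qed
  then have "measure M {x} \<le> 0" by (rule field_le_epsilon)
  then show ?thesis using measure_nonneg[of M "{x}"] by linarith
qed

lemma has_derivative_cdf_inverse_fourier: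
  assumes \<phi>: "integrable lborel (char M)"
  shows "(cdf M has_real_derivative Re (inverse_fourier (char M) x)) (at x)"
proof -
  let ?h = "inverse_fourier (char M)"
  let ?F = "\<lambda>y. cdf M (x - 1) + integral {x - 1..y} (\<lambda>s. Re (?h s))"
  have "continuous_on {x - 1..x + 1} (\<lambda>s. Re (?h s))"
    by (intro continuous_intros continuous_on_inverse_fourier \<phi>)
  from integral_has_real_derivative[OF this, of x]
  have "((\<lambda>y. integral {x - 1..y} (\<lambda>s. Re (?h s))) has_real_derivative Re (?h x)) (at x within {x - 1..x + 1})"
    by simp
  moreover have "at x within {x - 1..x + 1} = at x"
    by (rule at_within_interior) simp
  ultimately have "((\<lambda>y. integral {x - 1..y} (\<lambda>s. Re (?h s))) has_real_derivative Re (?h x)) (at x)"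
    by (simp only:)
  from DERIV_add[OF DERIV_const[of "cdf M (x - 1)"] this]
  have "(?F has_real_derivative Re (?h x)) (at x)" by (simp only: add_0)
  note F = this
  have eq: "?F y = cdf M y" if "y \<in> {x - 1<..<x + 1}" for y
  proof -
    have "?h integrable_on {x - 1..y}"
      by (intro integrable_continuous_real continuous_on_inverse_fourier \<phi>)
    from integral_linear[OF this bounded_linear_Re]
    have "integral {x - 1..y} (\<lambda>s. Re (?h s)) = Re (integral {x - 1..y} ?h)"
      by (simp add: comp_def)
    also have "integral {x - 1..y} ?h = measure M {x - 1<..y}"
      using that by (intro measure_Ioc_inverse_fourier_continuity_points[symmetric] \<phi>
        no_atoms_if_integrable_char) auto
    also have "Re (measure M {x - 1<..y}) = measure M {x - 1<..y}" by simp
    also have "\<dots> = cdf M y - cdf M (x - 1)"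
      using that by (subst cdf_diff_eq) auto
    finally show ?thesis by simp
  qed
  show ?thesis
    by (rule has_field_derivative_transform_within_open[OF F, of "{x - 1<..<x + 1}"]) (simp_all add: eq del: greaterThanLessThan_iff, simp)
qed

text \<open>
  Off \<open>K\<close> the distribution function is locally constant, so its derivative vanishes there. If
  the complement of \<open>K\<close> were dense, the continuous derivative would vanish everywhere and the
  distribution function would be constant.
\<close>

lemma interior_nonempty_if_integrable_char:
  assumes \<phi>: "integrable lborel (char M)" and "closed K" and K: "AE x in M. x \<in> K"
  shows "interior K \<noteq> {}"
proof
  assume "interior K = {}"
  let ?h = "\<lambda>x. Re (inverse_fourier (char M) x)"
  note D = has_derivative_cdf_inverse_fourier[OF \<phi>]
  have h0: "?h x = 0" if "x \<in> - K" for x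
  proof -
    have "open (- K)" using \<open>closed K\<close> by (rule open_Compl)
    from openE[OF this \<open>x \<in> - K\<close>] obtain e where e: "e > 0" "ball x e \<subseteq> - K" .
    have "cdf M y = cdf M x" if "y \<in> ball x e" for y
    proof -
      have *: "cdf M u = cdf M v" if "u \<in> ball x e" "v \<in> ball x e" "u < v" for u v
      proof -
        have "{u<..v} \<subseteq> - K"
        proof
          fix z assume "z \<in> {u<..v}"
          with that have "z \<in> ball x e"
            unfolding ball_eq_greaterThanLessThan greaterThanLessThan_iff greaterThanAtMost_iff by linarith
          with e show "z \<in> - K" by blast
        qed
        then have "AE z in M. z \<notin> {u<..v}" by (intro eventually_mono[OF K]) blast
        then have "measure M {u<..v} = 0" by (intro prob_eq_0[THEN iffD2]) simp_all
        then show ?thesis using cdf_diff_eq[OF \<open>u < v\<close>] by linarith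
      qed
      have x: "x \<in> ball x e" using e by simp
      show ?thesis
        using *[OF x \<open>y \<in> ball x e\<close>] *[OF \<open>y \<in> ball x e\<close> x, symmetric]
        by (rule_tac linorder_cases[of x y]) (simp_all only:)
    qed
    then have eq: "cdf M y = (\<lambda>_. cdf M x) y" if "y \<in> ball x e" for y using that by simp
    have "((\<lambda>_. cdf M x) has_real_derivative ?h x) (at x)"
      using e by (intro has_field_derivative_transform_within_open[OF D open_ball _ eq]) simp_all
    from DERIV_unique[OF this DERIV_const] show ?thesis .
  qed
  have "closure (- K) = UNIV" using \<open>interior K = {}\<close> by (simp add: closure_interior)
  moreover have "closed {x. ?h x = 0}"
    using continuous_inverse_fourier[OF \<phi>]
    by (intro closed_Collect_eq continuous_intros continuous_at_imp_continuous_on) auto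
  ultimately have "?h x = 0" for x
    using h0 closure_minimal[of "- K" "{x. ?h x = 0}"] by auto
  then have "\<forall>x. DERIV (cdf M) x :> 0" using D by (simp only: simp_thms)
  then have const: "cdf M x = cdf M 0" for x by (rule DERIV_isconst_all)
  have "(\<lambda>n::nat. cdf M 0) \<longlonglongrightarrow> 1"
    using cdf_lim_infty_prob by (simp only: const[of "real n" for n])
  moreover have "(\<lambda>n::nat. cdf M 0) \<longlonglongrightarrow> 0"
    using cdf_lim_neg_infty by (simp only: const[of "- real n" for n])
  ultimately show False by (simp add: tendsto_const_iff)
qed

end

section \<open>Sums of supports\<close>

lemma interior_sumset_if_integrable:
  fixes x :: real
  assumes \<mu>: "prob_space \<mu>" "sets \<mu> = sets borel" "AE y in \<mu>. y \<in> {a..b}"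
    and \<nu>: "prob_space \<nu>" "sets \<nu> = sets borel" "AE y in \<nu>. y \<in> {c..d}"
    and fin: "(\<integral>\<^sup>+t. ennreal (norm (char \<mu> t)) * ennreal (norm (char \<nu> (x * t))) \<partial>lborel) < \<infinity>"
  shows "interior (measure_supp \<mu> + (\<lambda>y. x * y) ` measure_supp \<nu>) \<noteq> {}"
proof -
  let ?K = "measure_supp \<mu> + (\<lambda>y. x * y) ` measure_supp \<nu>"
  let ?\<kappa> = "distr (\<mu> \<Otimes>\<^sub>M \<nu>) borel (\<lambda>(y, z). y + x * z)"
  interpret \<mu>: prob_space \<mu> by fact
  interpret \<nu>: prob_space \<nu> by fact
  interpret P: pair_prob_space \<mu> \<nu> ..
  interpret M: real_distribution \<mu>
    by unfold_locales (simp_all add: \<mu> sets_eq_imp_space_eq[OF \<mu>(2)])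
  interpret N: real_distribution \<nu>
    by unfold_locales (simp_all add: \<nu> sets_eq_imp_space_eq[OF \<nu>(2)])
  have [measurable_cong]: "sets \<mu> = sets borel" "sets \<nu> = sets borel" by fact+
  have m[measurable]: "(\<lambda>(y, z). y + x * z) \<in> borel_measurable (\<mu> \<Otimes>\<^sub>M \<nu>)" by measurable
  interpret K: real_distribution ?\<kappa> using P.P.real_distribution_distr[OF m] .
  have char: "char ?\<kappa> t = char \<mu> t * char \<nu> (x * t)" for t
    using char_distr_pair_add[OF \<mu>(1) \<nu>(1), of "\<lambda>y. y" "\<lambda>z. x * z" t] \<mu>(2) \<nu>(2)
    by (simp add: char_distr_scale distr_id2 cong: measurable_cong_sets)
  have int: "integrable lborel (char ?\<kappa>)"
  proof (rule integrableI_bounded)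
    show "(\<integral>\<^sup>+t. norm (char ?\<kappa> t) \<partial>lborel) < \<infinity>"
      using fin by (simp add: char norm_mult ennreal_mult)
  qed measurable
  have "compact ?K"
  proof -
    have "compact ((\<lambda>y. x * y) ` measure_supp \<nu>)"
      using compact_measure_supp[OF \<nu>(2,3)]
      by (intro compact_continuous_image continuous_intros)
    from compact_sums[OF compact_measure_supp[OF \<mu>(2,3)] this]
    show ?thesis by (simp add: set_plus_def Bex_def conj_ac Collect_mono_iff)
  qed
  then have "closed ?K" by (rule compact_imp_closed)
  have "AE z in \<mu> \<Otimes>\<^sub>M \<nu>. fst z \<in> measure_supp \<mu> \<and> snd z \<in> measure_supp \<nu>"
  proof (rule P.AE_pair_measure)
    have [measurable]: "measure_supp \<mu> \<in> sets borel" "measure_supp \<nu> \<in> sets borel"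
      by (intro borel_closed closed_measure_supp)+
    show "{z \<in> space (\<mu> \<Otimes>\<^sub>M \<nu>). fst z \<in> measure_supp \<mu> \<and> snd z \<in> measure_supp \<nu>} \<in> sets (\<mu> \<Otimes>\<^sub>M \<nu>)"
      by measurable
    show "AE y in \<mu>. AE z in \<nu>. fst (y, z) \<in> measure_supp \<mu> \<and> snd (y, z) \<in> measure_supp \<nu>"
      using AE_in_measure_supp[OF \<mu>(2)] AE_in_measure_supp[OF \<nu>(2)] by simp
  qed
  then have "AE z in \<mu> \<Otimes>\<^sub>M \<nu>. (case z of (y, z) \<Rightarrow> y + x * z) \<in> ?K"
    by eventually_elim (auto intro!: set_plus_intro)
  then have "AE w in ?\<kappa>. w \<in> ?K"
    using \<open>closed ?K\<close> by (subst AE_distr_iff) (auto intro: borel_closed)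
  with int \<open>closed ?K\<close> show ?thesis by (intro K.interior_nonempty_if_integrable_char)
qed

text \<open>
  Both bases satisfy the numerical inequality of \<open>kernel_sum_bound_lt_sqrt\<close>. Its strictness enters
  through the first measure, where the geometric series has to converge.
\<close>

lemma AE_interior_sumset:
  fixes b c :: nat
  assumes b: "10 \<le> b" "b \<le> 11" and c: "10 \<le> c" "c \<le> 11"
  shows "AE x :: real in lebesgue.
     interior
       (measure_supp (missing_digits_measure (b ^ 10000) {1..b ^ 5005}) +
        (\<lambda>y. x * y) ` measure_supp (missing_digits_measure (c ^ 10000) {1..c ^ 5005})) \<noteq> {}"
proof -
  have gen: "b ^ 10000 \<ge> 2" "0 < b ^ 5005" "b ^ 5005 < b ^ 10000" if "10 \<le> b" for b :: nat
  proof -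
    have "b ^ 1 \<le> b ^ 10000" using that by (intro power_increasing) auto
    then show "b ^ 10000 \<ge> 2" using that by simp
    show "b ^ 5005 < b ^ 10000" using that by (intro power_strict_increasing) auto
    show "0 < b ^ 5005" using that by simp
  qed
  let ?B = "\<lambda>b::nat. 2 + 2 * real (b ^ 10000) / real (b ^ 5005) * (1 + ln (real (b ^ 10000)))"
  let ?\<mu> = "\<lambda>b::nat. missing_digits_measure (b ^ 10000) {1..b ^ 5005}"
  have B0: "0 \<le> ?B b" if "10 \<le> b" for b :: nat
    using gen[OF that] by (intro add_nonneg_nonneg mult_nonneg_nonneg) auto
  have sets: "sets (?\<mu> b) = sets borel" for b by (simp add: missing_digits_measure_def)
  have rd: "real_distribution (?\<mu> b)" for b
  proof -
    interpret prob_space "?\<mu> b" by (rule prob_space_missing_digits_measure)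
    show ?thesis by unfold_locales (simp_all add: missing_digits_measure_def)
  qed
  have supp: "AE y in ?\<mu> b. y \<in> {0..2}" if "10 \<le> b" for b :: nat
    by (rule AE_missing_digits_bounds[OF gen(1)[OF that]]) (use gen(2,3)[OF that] in auto)
  have win: "(\<integral>\<^sup>+t\<in>{-R..R}. norm (char (?\<mu> b) t) \<partial>lborel) \<le> ennreal (2 * pi * ?B b ^ n)"
    if "10 \<le> b" "0 \<le> R" "R \<le> real (b ^ 10000) ^ n" for b n R
    using char_missing_digits_window[OF gen[OF that(1)], of R n] that by simp
  have "AE x in lborel. (\<integral>\<^sup>+t. ennreal (norm (char (?\<mu> b) t)) * ennreal (norm (char (?\<mu> c) (x * t))) \<partial>lborel) < \<infinity>"
  proof (rule AE_finite_nn_integral_scaled_product)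
    interpret m1: real_distribution "?\<mu> b" by (rule rd)
    interpret m2: real_distribution "?\<mu> c" by (rule rd)
    show "(\<lambda>t. ennreal (norm (char (?\<mu> b) t))) \<in> borel_measurable borel"
      "(\<lambda>t. ennreal (norm (char (?\<mu> c) t))) \<in> borel_measurable borel" by measurable
    show "ennreal (norm (char (?\<mu> c) t)) \<le> 1" for t
      using m2.cmod_char_le_1[of t] by simp
    show "(\<integral>\<^sup>+t\<in>{-(real (b ^ 10000) ^ n)..real (b ^ 10000) ^ n}. norm (char (?\<mu> b) t) \<partial>lborel)
        \<le> ennreal (2 * pi * ?B b ^ n)" for n
      by (rule win[OF b(1)]) auto
    show "(\<integral>\<^sup>+t\<in>{-R..R}. norm (char (?\<mu> c) t) \<partial>lborel)
        \<le> ennreal (2 * pi * sqrt (real (c ^ 10000)) * sqrt R)" if "1 \<le> R" for R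
    proof (rule nn_integral_window_sqrt[where B="?B c"])
      show "(\<integral>\<^sup>+t\<in>{-R..R}. norm (char (?\<mu> c) t) \<partial>lborel) \<le> ennreal (2 * pi * ?B c ^ n)"
        if "0 \<le> R" "R \<le> real ((c ^ 10000) ^ n)" for n R
        by (rule win[OF c(1) that(1)]) (use that(2) in simp)
      show "1 < c ^ 10000" using gen(1)[OF c(1)] by linarith
      show "?B c \<le> sqrt (real (c ^ 10000))" using kernel_sum_bound_lt_sqrt[OF c] by (rule less_imp_le)
      show "0 \<le> 2 * pi" by simp
    qed (rule B0[OF c(1)] that)+
    show "0 \<le> ?B b" "?B b < sqrt (real (b ^ 10000))"
      by (rule B0[OF b(1)] kernel_sum_bound_lt_sqrt[OF b])+
    show "b ^ 10000 > 1" using gen[OF b(1)] by linarith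
  qed auto
  then have "AE x in lborel. interior (measure_supp (?\<mu> b) + (\<lambda>y. x * y) ` measure_supp (?\<mu> c)) \<noteq> {}"
    by eventually_elim
       (rule interior_sumset_if_integrable[OF prob_space_missing_digits_measure sets supp[OF b(1)]
          prob_space_missing_digits_measure sets supp[OF c(1)]])
  then show ?thesis by (rule AE_completion)
qed

theorem mainTheorem3:
  "AE x :: real in lebesgue.
     interior
       (measure_supp (missing_digits_measure (10 ^ 10000) {1..10 ^ 5005}) +
        (\<lambda>y. x * y) ` measure_supp (missing_digits_measure (11 ^ 10000) {1..11 ^ 5005})) \<noteq> {}"
  by (rule AE_interior_sumset) simp_all

end
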